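(* Let ${}^{*}X$ be a directed functional extension of $X$, and let $I$, $\widehat{\alpha}$ ($\alpha\in{}^{*}X$), $\mathcal D$ and $\mathcal E$ be constructed as described in the context (for any admissible choices of the functions $f_{\xi\alpha}$ and of the ultrafilter $\mathcal V$). Then the map $\alpha\mapsto[\widehat{\alpha}]$ is an isomorphism of ${}^{*}X$ onto the limit ultrapower $X^{I}/\mathcal D\,|\,\mathcal E$ as structures for the language $\mathcal L=\{f\mid f:X\to X\}$; that is, it is a bijection from ${}^{*}X$ onto $X^I/\mathcal D\,|\,\mathcal E$ and, for every $g:X\to X$ and $\alpha\in{}^{*}X$, $[\widehat{{}^{*}g(\alpha)}]=[g\circ\widehat{\alpha}]$.
   Context: $X$ is a set with distinct elements $0,1\in X$. A functional extension of $X$ is a superset ${}^{*}X\supseteq X$ with an assignment to each $f:X\to X$ of ${}^{*}f:{}^{*}X\to{}^{*}X$ extending $f$ such that for all $f,g:X\to X$, $\xi\in{}^{*}X$: (comp) ${}^{*}g({}^{*}f(\xi))={}^{*}(g\circ f)(\xi)$; (diag) ${}^{*}(\chi\circ(f,g))(\xi)=1$ if ${}^{*}f(\xi)={}^{*}g(\xi)$ and $0$ otherwise, where $\chi:X\times X\to\{0,1\}$ is the characteristic function of the diagonal and $\chi\circ(f,g)$ is $x\mapsto\chi(f(x),g(x))$. It is directed if (dir) for all $\xi,\eta\in{}^{*}X$ there exist $f,g:X\to X$ and $\zeta\in{}^{*}X$ with ${}^{*}f(\zeta)=\xi$, ${}^{*}g(\zeta)=\eta$. For $A\subseteq X$, ${}^{*}A=\{\xi\mid{}^{*}\chi_A(\xi)=1\}$,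 $\chi_A$ the characteristic function of $A$. Construction: for $\alpha\in{}^{*}X$ let $\check\alpha=\{\xi\in{}^{*}X\mid \exists f:X\to X,\ {}^{*}f(\xi)=\alpha\}$ and for each $\xi\in\check\alpha$ fix $f_{\xi\alpha}:X\to X$ with ${}^{*}f_{\xi\alpha}(\xi)=\alpha$. The family $\{\check\alpha\mid\alpha\in{}^{*}X\}$ has the finite intersection property; let $\mathcal V$ be any ultrafilter on ${}^{*}X$ containing it. Put $I={}^{*}X\times X$ and define $\widehat\alpha:I\to X$ by $\widehat\alpha(\xi,x)=f_{\xi\alpha}(x)$ if $\xi\in\check\alpha$ and $\widehat\alpha(\xi,x)=x$ otherwise; let $E_\alpha=\{(i,j)\in I\times I\mid\widehat\alpha(i)=\widehat\alpha(j)\}$, and let $\mathcal E$ be the filter of equivalence relations on $I$ generated by $\{E_\alpha\mid\alpha\in{}^{*}X\}$ (i.e. all equivalence relations on $I$ containing some $E_\alpha$). For $\xi\in{}^{*}X$ let $\mathcal U_\xi=\{A\subseteq X\mid\xi\in{}^{*}A\}$, and let $\mathcal D$ be the ultrafilter on $I$ given by $D\in\mathcal D\iff\{\xi\in{}^{*}X\mid\{x\in X\mid(\xi,x)\in D\}\in\mathcal U_\xi\}\in\mathcal V$. Ultrapowers: for an ultrafilter $\mathcal U$ on $I$, $X^I/\mathcal U$ is the set of classes $[f]$ of functions $f:I\to X$ modulo agreement on a set in $\mathcal U$; each $g:X\to X$ is interpreted by $\bar g([f])=[g\circ f]$. For a filter $\mathcal E$ of equivalence relations on $I$, the limit ultrapower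 $X^I/\mathcal U\,|\,\mathcal E$ is the subset of classes $[f]$ of those $f:I\to X$ with $\{(i,j)\mid f(i)=f(j)\}\in\mathcal E$, with the induced interpretation of each $g$. *)

theory Defs
  imports Main "HOL-Library.FuncSet"
begin

text \<open>
  All carriers are sets, so that \<open>*X\<close> is literally a superset of \<open>X\<close>. A function \<open>X \<rightarrow> X\<close> is an element
  of the extensional function space \<open>X \<rightarrow>\<^sub>E X\<close>, so that equality of such functions is equality on \<open>X\<close>.
\<close>

definition char_fun :: "'a set \<Rightarrow> 'a \<Rightarrow> 'a \<Rightarrow> 'a set \<Rightarrow> 'a \<Rightarrow> 'a" where
  "char_fun X zero one A = (\<lambda>x\<in>X. if x \<in> A then one else zero)"

definition diag_fun :: "'a \<Rightarrow> 'a \<Rightarrow> 'a \<Rightarrow> 'a \<Rightarrow> 'a" where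
  "diag_fun zero one x y = (if x = y then one else zero)"

locale functional_extension =
  fixes X :: "'a set" and zero one :: 'a
    and SX :: "'a set"
    and star :: "('a \<Rightarrow> 'a) \<Rightarrow> 'a \<Rightarrow> 'a"
  assumes zero_in: "zero \<in> X" and one_in: "one \<in> X" and zero_neq_one: "zero \<noteq> one"
    and superset: "X \<subseteq> SX"
    and star_fun: "f \<in> X \<rightarrow>\<^sub>E X \<Longrightarrow> star f \<in> SX \<rightarrow> SX"
    and star_extends: "f \<in> X \<rightarrow>\<^sub>E X \<Longrightarrow> x \<in> X \<Longrightarrow> star f x = f x"
    and comp: "f \<in> X \<rightarrow>\<^sub>E X \<Longrightarrow> g \<in> X \<rightarrow>\<^sub>E X \<Longrightarrow> \<xi> \<in> SX \<Longrightarrow>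
      star g (star f \<xi>) = star (compose X g f) \<xi>"
    and diag: "f \<in> X \<rightarrow>\<^sub>E X \<Longrightarrow> g \<in> X \<rightarrow>\<^sub>E X \<Longrightarrow> \<xi> \<in> SX \<Longrightarrow>
      star (\<lambda>x\<in>X. diag_fun zero one (f x) (g x)) \<xi> = (if star f \<xi> = star g \<xi> then one else zero)"

locale directed_functional_extension = functional_extension +
  assumes dir: "\<xi> \<in> SX \<Longrightarrow> \<eta> \<in> SX \<Longrightarrow>
    \<exists>f \<in> X \<rightarrow>\<^sub>E X. \<exists>g \<in> X \<rightarrow>\<^sub>E X. \<exists>\<zeta> \<in> SX. star f \<zeta> = \<xi> \<and> star g \<zeta> = \<eta>"

definition star_set ::
  "'a set \<Rightarrow> 'a \<Rightarrow> 'a \<Rightarrow> 'a set \<Rightarrow> (('a \<Rightarrow> 'a) \<Rightarrow> 'a \<Rightarrow> 'a) \<Rightarrow> 'a set \<Rightarrow> 'a set" where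
  "star_set X zero one SX star A = {\<xi> \<in> SX. star (char_fun X zero one A) \<xi> = one}"

definition ultrafilter_on :: "'i set \<Rightarrow> 'i set set \<Rightarrow> bool" where
  "ultrafilter_on S U \<longleftrightarrow>
     U \<subseteq> Pow S \<and> S \<in> U \<and> {} \<notin> U \<and>
     (\<forall>A\<in>U. \<forall>B\<in>U. A \<inter> B \<in> U) \<and>
     (\<forall>A\<in>U. \<forall>B. A \<subseteq> B \<and> B \<subseteq> S \<longrightarrow> B \<in> U) \<and>
     (\<forall>A. A \<subseteq> S \<longrightarrow> A \<in> U \<or> S - A \<in> U)"

definition eq_kernel :: "'i set \<Rightarrow> ('i \<Rightarrow> 'a) \<Rightarrow> ('i \<times> 'i) set" where
  "eq_kernel I h = {(i, j) \<in> I \<times> I. h i = h j}"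

definition ultrapower_rel ::
  "'a set \<Rightarrow> 'i set \<Rightarrow> 'i set set \<Rightarrow> (('i \<Rightarrow> 'a) \<times> ('i \<Rightarrow> 'a)) set" where
  "ultrapower_rel X I U =
     {(f, g) \<in> (I \<rightarrow>\<^sub>E X) \<times> (I \<rightarrow>\<^sub>E X). {i \<in> I. f i = g i} \<in> U}"

definition ultrapower_class ::
  "'a set \<Rightarrow> 'i set \<Rightarrow> 'i set set \<Rightarrow> ('i \<Rightarrow> 'a) \<Rightarrow> ('i \<Rightarrow> 'a) set" where
  "ultrapower_class X I U f = ultrapower_rel X I U `` {f}"

definition ultrapower :: "'a set \<Rightarrow> 'i set \<Rightarrow> 'i set set \<Rightarrow> ('i \<Rightarrow> 'a) set set" where
  "ultrapower X I U = (I \<rightarrow>\<^sub>E X) // ultrapower_rel X I U"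

text \<open>
  The interpretation of \<open>g\<close> on classes. The union ranges over all representatives of \<open>c\<close>; for an
  ultrafilter it is the single class of \<open>g \<circ> f\<close> for any \<open>f \<in> c\<close>, see \<open>ultrapower_fun_class\<close>.
\<close>

definition ultrapower_fun ::
  "'a set \<Rightarrow> 'i set \<Rightarrow> 'i set set \<Rightarrow> ('a \<Rightarrow> 'a) \<Rightarrow> ('i \<Rightarrow> 'a) set \<Rightarrow> ('i \<Rightarrow> 'a) set" where
  "ultrapower_fun X I U g c = (\<Union>f\<in>c. ultrapower_class X I U (compose I g f))"

definition limit_ultrapower ::
  "'a set \<Rightarrow> 'i set \<Rightarrow> 'i set set \<Rightarrow> ('i \<times> 'i) set set \<Rightarrow> ('i \<Rightarrow> 'a) set set" where
  "limit_ultrapower X I U \<E> =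
     {c \<in> ultrapower X I U. \<exists>f \<in> I \<rightarrow>\<^sub>E X. c = ultrapower_class X I U f \<and> eq_kernel I f \<in> \<E>}"

lemma equiv_ultrapower_rel:
  assumes "ultrafilter_on I U"
  shows "equiv (I \<rightarrow>\<^sub>E X) (ultrapower_rel X I U)"
proof (rule equivI)
  show "ultrapower_rel X I U \<subseteq> (I \<rightarrow>\<^sub>E X) \<times> (I \<rightarrow>\<^sub>E X)"
    by (auto simp: ultrapower_rel_def)
  show "refl_on (I \<rightarrow>\<^sub>E X) (ultrapower_rel X I U)"
    using assms by (auto simp: refl_on_def ultrapower_rel_def ultrafilter_on_def)
  show "sym (ultrapower_rel X I U)"
    by (auto simp: sym_def ultrapower_rel_def eq_commute)
  show "trans (ultrapower_rel X I U)"
  proof (rule transI)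
    fix f g h
    assume fg: "(f, g) \<in> ultrapower_rel X I U" and gh: "(g, h) \<in> ultrapower_rel X I U"
    then have "{i \<in> I. f i = g i} \<inter> {i \<in> I. g i = h i} \<in> U"
      using assms by (auto simp: ultrapower_rel_def ultrafilter_on_def)
    moreover have "{i \<in> I. f i = g i} \<inter> {i \<in> I. g i = h i} \<subseteq> {i \<in> I. f i = h i}" by auto
    moreover have "{i \<in> I. f i = h i} \<subseteq> I" by auto
    ultimately have "{i \<in> I. f i = h i} \<in> U"
      using assms unfolding ultrafilter_on_def by meson
    then show "(f, h) \<in> ultrapower_rel X I U"
      using fg gh by (auto simp: ultrapower_rel_def)
  qed
qed

lemma ultrapower_fun_class:
  assumes U: "ultrafilter_on I U" and g: "g \<in> X \<rightarrow>\<^sub>E X" and f: "f \<in> I \<rightarrow>\<^sub>E X"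
  shows "ultrapower_fun X I U g (ultrapower_class X I U f) =
    ultrapower_class X I U (compose I g f)"
proof -
  note eq = equiv_ultrapower_rel[OF U, of X]
  have "(\<lambda>f. ultrapower_class X I U (compose I g f)) respects ultrapower_rel X I U"
  proof (rule congruentI)
    fix h k assume hk: "(h, k) \<in> ultrapower_rel X I U"
    have "{i \<in> I. h i = k i} \<subseteq> {i \<in> I. compose I g h i = compose I g k i}"
      by (auto simp: compose_def)
    moreover have "{i \<in> I. compose I g h i = compose I g k i} \<subseteq> I" by auto
    moreover have "{i \<in> I. h i = k i} \<in> U" using hk by (auto simp: ultrapower_rel_def)
    ultimately have "{i \<in> I. compose I g h i = compose I g k i} \<in> U"
      using U unfolding ultrafilter_on_def by meson
    moreover have "compose I g h \<in> I \<rightarrow>\<^sub>E X" "compose I g k \<in> I \<rightarrow>\<^sub>E X"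
      using hk g by (auto simp: ultrapower_rel_def compose_def PiE_iff)
    ultimately have "(compose I g h, compose I g k) \<in> ultrapower_rel X I U"
      by (simp add: ultrapower_rel_def)
    then show "ultrapower_class X I U (compose I g h) = ultrapower_class X I U (compose I g k)"
      unfolding ultrapower_class_def using eq by (rule equiv_class_eq[rotated])
  qed
  then show ?thesis
    unfolding ultrapower_fun_def using UN_equiv_class[OF eq _ f]
    by (simp add: ultrapower_class_def)
qed

text \<open>
  Isomorphism of structures for the language with one unary function symbol for each
  \<open>g : X \<rightarrow> X\<close>. A structure is a carrier together with an interpretation of these symbols.
\<close>

definition fun_language_iso ::
  "'a set \<Rightarrow> 'b set \<Rightarrow> (('a \<Rightarrow> 'a) \<Rightarrow> 'b \<Rightarrow> 'b) \<Rightarrow> 'c set \<Rightarrow> (('a \<Rightarrow> 'a) \<Rightarrow> 'c \<Rightarrow> 'c)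
    \<Rightarrow> ('b \<Rightarrow> 'c) \<Rightarrow> bool" where
  "fun_language_iso X A intA B intB \<phi> \<longleftrightarrow>
     bij_betw \<phi> A B \<and> (\<forall>g \<in> X \<rightarrow>\<^sub>E X. \<forall>a \<in> A. \<phi> (intA g a) = intB g (\<phi> a))"

definition check_set ::
  "'a set \<Rightarrow> 'a set \<Rightarrow> (('a \<Rightarrow> 'a) \<Rightarrow> 'a \<Rightarrow> 'a) \<Rightarrow> 'a \<Rightarrow> 'a set" where
  "check_set X SX star \<alpha> = {\<xi> \<in> SX. \<exists>f \<in> X \<rightarrow>\<^sub>E X. star f \<xi> = \<alpha>}"

text \<open>\<open>F \<xi> \<alpha>\<close> is the chosen function \<open>f\<^sub>\<xi>\<^sub>\<alpha>\<close>; it is only constrained for \<open>\<xi>\<close> in the check set of \<open>\<alpha>\<close>.\<close>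

definition admissible_choice ::
  "'a set \<Rightarrow> 'a set \<Rightarrow> (('a \<Rightarrow> 'a) \<Rightarrow> 'a \<Rightarrow> 'a) \<Rightarrow> ('a \<Rightarrow> 'a \<Rightarrow> 'a \<Rightarrow> 'a) \<Rightarrow> bool" where
  "admissible_choice X SX star F \<longleftrightarrow>
     (\<forall>\<alpha>\<in>SX. \<forall>\<xi> \<in> check_set X SX star \<alpha>. F \<xi> \<alpha> \<in> X \<rightarrow>\<^sub>E X \<and> star (F \<xi> \<alpha>) \<xi> = \<alpha>)"

definition hat_fun ::
  "'a set \<Rightarrow> 'a set \<Rightarrow> (('a \<Rightarrow> 'a) \<Rightarrow> 'a \<Rightarrow> 'a) \<Rightarrow> ('a \<Rightarrow> 'a \<Rightarrow> 'a \<Rightarrow> 'a)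
    \<Rightarrow> 'a \<Rightarrow> 'a \<times> 'a \<Rightarrow> 'a" where
  "hat_fun X SX star F \<alpha> =
     (\<lambda>(\<xi>, x) \<in> SX \<times> X. if \<xi> \<in> check_set X SX star \<alpha> then F \<xi> \<alpha> x else x)"

definition point_ultrafilter ::
  "'a set \<Rightarrow> 'a \<Rightarrow> 'a \<Rightarrow> 'a set \<Rightarrow> (('a \<Rightarrow> 'a) \<Rightarrow> 'a \<Rightarrow> 'a) \<Rightarrow> 'a \<Rightarrow> 'a set set" where
  "point_ultrafilter X zero one SX star \<xi> = {A. A \<subseteq> X \<and> \<xi> \<in> star_set X zero one SX star A}"

definition product_ultrafilter ::
  "'a set \<Rightarrow> 'a \<Rightarrow> 'a \<Rightarrow> 'a set \<Rightarrow> (('a \<Rightarrow> 'a) \<Rightarrow> 'a \<Rightarrow> 'a) \<Rightarrow> 'a set set \<Rightarrow> ('a \<times> 'a) set set" where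
  "product_ultrafilter X zero one SX star V =
     {D. D \<subseteq> SX \<times> X \<and>
         {\<xi> \<in> SX. {x \<in> X. (\<xi>, x) \<in> D} \<in> point_ultrafilter X zero one SX star \<xi>} \<in> V}"

text \<open>
  All equivalence relations on \<open>I\<close> containing some member of \<open>G\<close>. Finite intersections of members of
  \<open>G\<close> are not added: if \<open>G\<close> consists of the kernels of the functions \<open>hat \<alpha>\<close>, adding them does not
  change the resulting limit ultrapower, since by directedness any two \<open>hat \<alpha>\<close>, \<open>hat \<beta>\<close> agree modulo
  the ultrafilter with \<open>p \<circ> hat \<gamma>\<close>, \<open>q \<circ> hat \<gamma>\<close> for a common \<open>\<gamma>\<close>.
\<close>

definition generated_equivs :: "'i set \<Rightarrow> ('i \<times> 'i) set set \<Rightarrow> ('i \<times> 'i) set set" where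
  "generated_equivs I G = {R. equiv I R \<and> (\<exists>E\<in>G. E \<subseteq> R)}"

end

theory Submission
  imports Defs
begin

text \<open>
  A function \<open>f\<close> on \<open>I = *X \<times> X\<close> has at each \<open>\<xi>\<close> the value \<open>*(f(\<xi>, \<cdot>))(\<xi>)\<close> in \<open>*X\<close>. By (diag), two
  such functions agree modulo \<open>\<D>\<close> iff their values agree at \<open>\<V>\<close>-almost every \<open>\<xi>\<close>; by (comp), the
  value of \<open>g \<circ> f\<close> is \<open>*g\<close> of the value of \<open>f\<close>. Since \<open>hat \<alpha>\<close> has the value \<open>\<alpha>\<close> at every \<open>\<xi>\<close> in the
  check set of \<open>\<alpha>\<close>, which belongs to \<open>\<V>\<close>, the map \<open>\<alpha> \<mapsto> [hat \<alpha>]\<close> is injective and a homomorphism.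
  It is onto because a function on \<open>I\<close> whose kernel contains that of \<open>hat \<alpha>\<close> factors as
  \<open>g \<circ> hat \<alpha>\<close>, and so represents the image of \<open>*g \<alpha>\<close>.
\<close>

lemma PiE_compose: "f \<in> A \<rightarrow>\<^sub>E B \<Longrightarrow> g \<in> B \<rightarrow>\<^sub>E C \<Longrightarrow> compose A g f \<in> A \<rightarrow>\<^sub>E C"
  by (auto simp: PiE_iff compose_def)

lemma ultrafilter_on_Compl_iff:
  assumes U: "ultrafilter_on S U" and A: "A \<subseteq> S"
  shows "S - A \<in> U \<longleftrightarrow> A \<notin> U"
proof -
  have "A \<inter> (S - A) \<notin> U"
    using U by (simp add: ultrafilter_on_def)
  then have "\<not> (A \<in> U \<and> S - A \<in> U)"
    using U unfolding ultrafilter_on_def by meson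
  moreover have "A \<in> U \<or> S - A \<in> U"
    using U A by (simp add: ultrafilter_on_def)
  ultimately show ?thesis
    by blast
qed

lemma ultrafilter_on_Int_iff:
  assumes "ultrafilter_on S U" and "A \<subseteq> S" and "B \<subseteq> S"
  shows "A \<inter> B \<in> U \<longleftrightarrow> A \<in> U \<and> B \<in> U"
proof
  assume "A \<inter> B \<in> U"
  moreover have "C \<in> U" if "A \<inter> B \<in> U" "A \<inter> B \<subseteq> C" "C \<subseteq> S" for C
    using assms(1) that unfolding ultrafilter_on_def by meson
  ultimately show "A \<in> U \<and> B \<in> U"
    using assms(2,3) by (meson Int_lower1 Int_lower2)
qed (use assms(1) in \<open>simp add: ultrafilter_on_def\<close>)

lemma ultrafilter_onI:
  assumes sub: "U \<subseteq> Pow S"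
    and Compl: "\<And>A. A \<subseteq> S \<Longrightarrow> S - A \<in> U \<longleftrightarrow> A \<notin> U"
    and Int: "\<And>A B. A \<subseteq> S \<Longrightarrow> B \<subseteq> S \<Longrightarrow> A \<inter> B \<in> U \<longleftrightarrow> A \<in> U \<and> B \<in> U"
  shows "ultrafilter_on S U"
proof -
  have empty: "{} \<notin> U"
    using Compl[of "{}"] Int[of "{}" S] by auto
  show ?thesis
    unfolding ultrafilter_on_def
  proof (intro conjI ballI allI impI)
    show "S \<in> U"
      using Compl[of S] empty by simp
    show "A \<inter> B \<in> U" if "A \<in> U" "B \<in> U" for A B
      using Int[of A B] that sub by blast
    show "B \<in> U" if "A \<in> U" "A \<subseteq> B \<and> B \<subseteq> S" for A B
      using Int[of A B] that by (auto simp: Int_absorb2)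
    show "A \<in> U \<or> S - A \<in> U" if "A \<subseteq> S" for A
      using Compl[OF that] by simp
  qed (fact sub empty)+
qed

lemma ultrafilter_on_Collect_const_iff:
  assumes U: "ultrafilter_on S U" and K: "K \<in> U" and P: "\<And>x. x \<in> K \<Longrightarrow> P x \<longleftrightarrow> Q"
  shows "{x \<in> S. P x} \<in> U \<longleftrightarrow> Q"
proof -
  have K_sub: "K \<subseteq> S" and empty: "{} \<notin> U"
    using U K by (auto simp: ultrafilter_on_def)
  have "{x \<in> S. P x} \<in> U \<longleftrightarrow> {x \<in> S. P x} \<inter> K \<in> U"
    using ultrafilter_on_Int_iff[OF U _ K_sub, of "{x \<in> S. P x}"] K by auto
  also have "{x \<in> S. P x} \<inter> K = (if Q then K else {})"
    using P K_sub by auto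
  finally show ?thesis
    using K empty by simp
qed

text \<open>
  Complementation and pairwise intersection alone would not suffice: consider the majorities among
  three points.
\<close>

lemma ultrafilter_onI_not_disjoint:
  assumes sub: "U \<subseteq> Pow S"
    and iff: "\<And>A B. A \<subseteq> S \<Longrightarrow> B \<subseteq> S \<Longrightarrow> {x \<in> S. x \<in> A \<longleftrightarrow> x \<in> B} \<in> U \<longleftrightarrow> (A \<in> U \<longleftrightarrow> B \<in> U)"
    and meet: "\<And>A B. A \<in> U \<Longrightarrow> B \<in> U \<Longrightarrow> A \<inter> B \<noteq> {}"
  shows "ultrafilter_on S U"
proof -
  have Compl: "S - A \<in> U \<longleftrightarrow> A \<notin> U" if "A \<subseteq> S" for A
  proof -
    have "S - A = {x \<in> S. x \<in> A \<longleftrightarrow> x \<in> {}}" by auto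
    then show ?thesis
      using iff[OF that, of "{}"] meet[of "{}" "{}"] by auto
  qed
  have superset: "B \<in> U" if "A \<in> U" "A \<subseteq> B" "B \<subseteq> S" for A B
    using meet[of A "S - B"] Compl[of B] that by blast
  have Int: "A \<inter> B \<in> U" if "A \<in> U" "B \<in> U" for A B
  proof -
    let ?agree = "{x \<in> S. x \<in> A \<longleftrightarrow> x \<in> B}" and ?neither = "S - (A \<union> B)"
    have AB: "A \<subseteq> S" "B \<subseteq> S"
      using that sub by auto
    have "?agree \<in> U"
      using iff[OF AB] that by simp
    moreover have "?neither \<notin> U"
      using meet[OF that(1), of ?neither] by blast
    moreover have "{x \<in> S. x \<in> ?agree \<longleftrightarrow> x \<in> ?neither} = S - A \<inter> B"
      by blast
    ultimately have "S - A \<inter> B \<notin> U"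
      using iff[of ?agree ?neither] by simp
    then show ?thesis
      using Compl[of "A \<inter> B"] AB by blast
  qed
  have "A \<inter> B \<in> U \<longleftrightarrow> A \<in> U \<and> B \<in> U" if "A \<subseteq> S" "B \<subseteq> S" for A B
    using Int superset[OF _ Int_lower1 that(1)] superset[OF _ Int_lower2 that(2)] by blast
  with sub Compl show ?thesis
    by (rule ultrafilter_onI)
qed

definition sum_ultrafilter ::
  "'i set \<Rightarrow> ('i \<Rightarrow> 'a set) \<Rightarrow> 'i set set \<Rightarrow> ('i \<Rightarrow> 'a set set) \<Rightarrow> ('i \<times> 'a) set set" where
  "sum_ultrafilter S T V U =
     {D. D \<subseteq> Sigma S T \<and> {\<xi> \<in> S. {x \<in> T \<xi>. (\<xi>, x) \<in> D} \<in> U \<xi>} \<in> V}"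

lemma Collect_in_sum_ultrafilter_iff:
  "{i \<in> Sigma S T. P i} \<in> sum_ultrafilter S T V U \<longleftrightarrow>
    {\<xi> \<in> S. {x \<in> T \<xi>. P (\<xi>, x)} \<in> U \<xi>} \<in> V"
proof -
  have "{x \<in> T \<xi>. (\<xi>, x) \<in> {i \<in> Sigma S T. P i}} = {x \<in> T \<xi>. P (\<xi>, x)}" if "\<xi> \<in> S" for \<xi>
    using that by auto
  then show ?thesis
    by (simp add: sum_ultrafilter_def cong: conj_cong)
qed

lemma ultrafilter_on_sum_ultrafilter:
  assumes V: "ultrafilter_on S V" and U: "\<And>\<xi>. \<xi> \<in> S \<Longrightarrow> ultrafilter_on (T \<xi>) (U \<xi>)"
  shows "ultrafilter_on (Sigma S T) (sum_ultrafilter S T V U)"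
proof (rule ultrafilter_onI)
  let ?slice = "\<lambda>D \<xi>. {x \<in> T \<xi>. (\<xi>, x) \<in> D}"
  let ?base = "\<lambda>D. {\<xi> \<in> S. ?slice D \<xi> \<in> U \<xi>}"
  have in_iff: "D \<in> sum_ultrafilter S T V U \<longleftrightarrow> ?base D \<in> V" if "D \<subseteq> Sigma S T" for D
    using that by (simp add: sum_ultrafilter_def)
  show "sum_ultrafilter S T V U \<subseteq> Pow (Sigma S T)"
    by (auto simp: sum_ultrafilter_def)
  fix A assume A: "A \<subseteq> Sigma S T"
  have "?slice (Sigma S T - A) \<xi> \<in> U \<xi> \<longleftrightarrow> ?slice A \<xi> \<notin> U \<xi>" if "\<xi> \<in> S" for \<xi>
  proof -
    have "?slice (Sigma S T - A) \<xi> = T \<xi> - ?slice A \<xi>"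
      using that by auto
    then show ?thesis
      using ultrafilter_on_Compl_iff[OF U[OF that], of "?slice A \<xi>"] by simp
  qed
  then have "?base (Sigma S T - A) = S - ?base A"
    by blast
  then show "Sigma S T - A \<in> sum_ultrafilter S T V U \<longleftrightarrow> A \<notin> sum_ultrafilter S T V U"
    using ultrafilter_on_Compl_iff[OF V, of "?base A"] A by (simp add: in_iff)
  fix B assume B: "B \<subseteq> Sigma S T"
  have "?slice (A \<inter> B) \<xi> \<in> U \<xi> \<longleftrightarrow> ?slice A \<xi> \<in> U \<xi> \<and> ?slice B \<xi> \<in> U \<xi>" if "\<xi> \<in> S" for \<xi>
  proof -
    have "?slice (A \<inter> B) \<xi> = ?slice A \<xi> \<inter> ?slice B \<xi>"
      by auto
    then show ?thesis
      using ultrafilter_on_Int_iff[OF U[OF that], of "?slice A \<xi>" "?slice B \<xi>"] by simp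
  qed
  then have "?base (A \<inter> B) = ?base A \<inter> ?base B"
    by blast
  then show "A \<inter> B \<in> sum_ultrafilter S T V U \<longleftrightarrow>
      A \<in> sum_ultrafilter S T V U \<and> B \<in> sum_ultrafilter S T V U"
    using ultrafilter_on_Int_iff[OF V, of "?base A" "?base B"] A B by (simp add: in_iff le_infI1)
qed

lemma ultrapower_class_eq_iff:
  assumes "ultrafilter_on I U" and "f \<in> I \<rightarrow>\<^sub>E X" and "g \<in> I \<rightarrow>\<^sub>E X"
  shows "ultrapower_class X I U f = ultrapower_class X I U g \<longleftrightarrow> {i \<in> I. f i = g i} \<in> U"
  using eq_equiv_class_iff[OF equiv_ultrapower_rel[OF assms(1)] assms(2,3)] assms(2,3)
  by (simp add: ultrapower_class_def ultrapower_rel_def)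

lemma equiv_eq_kernel: "equiv I (eq_kernel I h)"
  by (rule equivI) (auto simp: eq_kernel_def refl_on_def sym_def trans_def)

lemma eq_kernel_subset_iff_factors:
  assumes h: "h \<in> I \<rightarrow>\<^sub>E X" and f: "f \<in> I \<rightarrow>\<^sub>E Y" and Y: "Y \<noteq> {}"
  shows "eq_kernel I h \<subseteq> eq_kernel I f \<longleftrightarrow> (\<exists>g \<in> X \<rightarrow>\<^sub>E Y. f = compose I g h)"
proof
  assume "eq_kernel I h \<subseteq> eq_kernel I f"
  then have "\<forall>i j. i \<in> I \<and> j \<in> I \<and> h i = h j \<longrightarrow> f i = f j"
    by (auto simp: eq_kernel_def)
  then have "\<exists>k. \<forall>i. i \<in> I \<longrightarrow> f i = k (h i)"
    by (rule iffD1[OF function_factors_left_gen])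
  then obtain k where k: "\<And>i. i \<in> I \<Longrightarrow> f i = k (h i)"
    by blast
  obtain y where "y \<in> Y"
    using Y by blast
  define g where "g = (\<lambda>x\<in>X. if k x \<in> Y then k x else y)"
  have "g \<in> X \<rightarrow>\<^sub>E Y"
    using \<open>y \<in> Y\<close> by (auto simp: g_def)
  moreover have "f = compose I g h"
  proof (rule extensionalityI)
    fix i assume "i \<in> I"
    then show "f i = compose I g h i"
      using PiE_mem[OF h] PiE_mem[OF f] k by (simp add: compose_eq g_def)
  qed (use f in \<open>auto simp: PiE_def\<close>)
  ultimately show "\<exists>g \<in> X \<rightarrow>\<^sub>E Y. f = compose I g h"
    by blast
qed (auto simp: eq_kernel_def compose_eq)

lemma limit_ultrapower_generated_equivs:
  assumes h: "\<And>a. a \<in> A \<Longrightarrow> h a \<in> I \<rightarrow>\<^sub>E X" and X: "X \<noteq> {}"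
  shows "limit_ultrapower X I U (generated_equivs I {eq_kernel I (h a) | a. a \<in> A}) =
    {ultrapower_class X I U (compose I g (h a)) | g a. g \<in> X \<rightarrow>\<^sub>E X \<and> a \<in> A}"
    (is "?L = ?R")
proof (intro equalityI subsetI)
  fix c assume "c \<in> ?L"
  then obtain f a where f: "f \<in> I \<rightarrow>\<^sub>E X" "c = ultrapower_class X I U f"
    and a: "a \<in> A" "eq_kernel I (h a) \<subseteq> eq_kernel I f"
    unfolding limit_ultrapower_def generated_equivs_def by blast
  obtain g where "g \<in> X \<rightarrow>\<^sub>E X" "f = compose I g (h a)"
    using a(2) unfolding eq_kernel_subset_iff_factors[OF h[OF a(1)] f(1) X] by blast
  then show "c \<in> ?R"
    using f(2) a(1) by blast
next
  fix c assume "c \<in> ?R"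
  then obtain g a where g: "g \<in> X \<rightarrow>\<^sub>E X" and a: "a \<in> A"
    and c: "c = ultrapower_class X I U (compose I g (h a))"
    by blast
  have f: "compose I g (h a) \<in> I \<rightarrow>\<^sub>E X"
    using PiE_compose[OF h[OF a] g] .
  then have "eq_kernel I (h a) \<subseteq> eq_kernel I (compose I g (h a))"
    using eq_kernel_subset_iff_factors[OF h[OF a] f X] g by blast
  then have "eq_kernel I (compose I g (h a)) \<in> generated_equivs I {eq_kernel I (h a) | a. a \<in> A}"
    using a equiv_eq_kernel unfolding generated_equivs_def by blast
  moreover have "c \<in> ultrapower X I U"
    using f unfolding c ultrapower_def ultrapower_class_def by (rule quotientI)
  ultimately show "c \<in> ?L"
    using f c unfolding limit_ultrapower_def by blast
qed

context functional_extension
begin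

abbreviation points :: "'a \<Rightarrow> 'a set set" where
  "points \<equiv> point_ultrafilter X zero one SX star"

lemma char_fun_in_PiE: "char_fun X zero one A \<in> X \<rightarrow>\<^sub>E X"
  using zero_in one_in by (auto simp: char_fun_def)

lemma in_points_iff:
  "\<xi> \<in> SX \<Longrightarrow> A \<in> points \<xi> \<longleftrightarrow> A \<subseteq> X \<and> star (char_fun X zero one A) \<xi> = one"
  by (auto simp: point_ultrafilter_def star_set_def)

lemma star_char_fun_equalizer:
  assumes "f \<in> X \<rightarrow>\<^sub>E X" and "g \<in> X \<rightarrow>\<^sub>E X" and "\<xi> \<in> SX"
  shows "star (char_fun X zero one {x \<in> X. f x = g x}) \<xi> =
    (if star f \<xi> = star g \<xi> then one else zero)"
proof -
  have "char_fun X zero one {x \<in> X. f x = g x} = (\<lambda>x\<in>X. diag_fun zero one (f x) (g x))"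
    by (auto simp: char_fun_def diag_fun_def)
  then show ?thesis
    using diag[OF assms] by simp
qed

lemma equalizer_in_points_iff:
  assumes "f \<in> X \<rightarrow>\<^sub>E X" and "g \<in> X \<rightarrow>\<^sub>E X" and "\<xi> \<in> SX"
  shows "{x \<in> X. f x = g x} \<in> points \<xi> \<longleftrightarrow> star f \<xi> = star g \<xi>"
  using star_char_fun_equalizer[OF assms] zero_neq_one assms(3) by (auto simp: in_points_iff)

lemma star_const:
  assumes a: "a \<in> X" and \<xi>: "\<xi> \<in> SX"
  shows "star (\<lambda>x\<in>X. a) \<xi> = a"
proof -
  have const_in: "(\<lambda>x\<in>X. b) \<in> X \<rightarrow>\<^sub>E X" if "b \<in> X" for b
    using that by auto
  have star_one: "star (\<lambda>x\<in>X. one) \<xi> = one"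
    using diag[OF const_in[OF a] const_in[OF a] \<xi>] a
    by (simp add: diag_fun_def cong: restrict_cong)
  have "compose X (\<lambda>x\<in>X. a) (\<lambda>x\<in>X. one) = (\<lambda>x\<in>X. a)"
    using one_in by (auto simp: compose_def)
  then have "star (\<lambda>x\<in>X. a) \<xi> = star (\<lambda>x\<in>X. a) (star (\<lambda>x\<in>X. one) \<xi>)"
    using comp[OF const_in[OF one_in] const_in[OF a] \<xi>] by simp
  also have "\<dots> = a"
    using star_one star_extends[OF const_in[OF a] one_in] one_in by simp
  finally show ?thesis .
qed

lemma preimage_in_points_iff:
  assumes "f \<in> X \<rightarrow>\<^sub>E X" and "a \<in> X" and "\<xi> \<in> SX"
  shows "{x \<in> X. f x = a} \<in> points \<xi> \<longleftrightarrow> star f \<xi> = a"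
proof -
  have "{x \<in> X. f x = a} = {x \<in> X. f x = (\<lambda>x\<in>X. a) x}" by auto
  then show ?thesis
    using equalizer_in_points_iff[of f "\<lambda>x\<in>X. a" \<xi>] assms star_const by auto
qed

lemma star_char_fun:
  assumes "A \<subseteq> X" and "\<xi> \<in> SX"
  shows "star (char_fun X zero one A) \<xi> = (if A \<in> points \<xi> then one else zero)"
proof -
  have const: "(\<lambda>x\<in>X. one) \<in> X \<rightarrow>\<^sub>E X"
    using one_in by auto
  have "{x \<in> X. char_fun X zero one A x = (\<lambda>x\<in>X. one) x} = A"
    using assms zero_neq_one by (auto simp: char_fun_def)
  from star_char_fun_equalizer[OF char_fun_in_PiE[of A] const assms(2), unfolded this]
  show ?thesis
    using assms by (simp add: in_points_iff star_const[OF one_in])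
qed

lemma iff_in_points_iff:
  assumes "A \<subseteq> X" and "B \<subseteq> X" and "\<xi> \<in> SX"
  shows "{x \<in> X. x \<in> A \<longleftrightarrow> x \<in> B} \<in> points \<xi> \<longleftrightarrow> (A \<in> points \<xi> \<longleftrightarrow> B \<in> points \<xi>)"
proof -
  have "{x \<in> X. x \<in> A \<longleftrightarrow> x \<in> B} = {x \<in> X. char_fun X zero one A x = char_fun X zero one B x}"
    using zero_neq_one by (auto simp: char_fun_def)
  then show ?thesis
    using equalizer_in_points_iff[OF char_fun_in_PiE[of A] char_fun_in_PiE[of B] assms(3)]
      assms zero_neq_one by (auto simp: star_char_fun)
qed

lemma empty_notin_points: "\<xi> \<in> SX \<Longrightarrow> {} \<notin> points \<xi>"
  using star_const[OF zero_in, of \<xi>] zero_neq_one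
  by (simp add: in_points_iff char_fun_def)

lemma points_not_disjoint:
  assumes \<xi>: "\<xi> \<in> SX" and "A \<in> points \<xi>" and "B \<in> points \<xi>"
  shows "A \<inter> B \<noteq> {}"
proof
  assume disj: "A \<inter> B = {}"
  have sub: "A \<subseteq> X" "B \<subseteq> X"
    using assms by (auto simp: in_points_iff)
  obtain a b where ab: "a \<in> A" "b \<in> B"
    using assms empty_notin_points by fastforce
  \<comment> \<open>A map sending \<open>A\<close> to \<open>a\<close>, \<open>B\<close> to \<open>b\<close> and nothing else to either would have
    star value both \<open>a\<close> and \<open>b\<close> at \<open>\<xi>\<close>.\<close>
  define f where "f = (\<lambda>x\<in>X. if x \<in> A then a else if x \<in> B then b else x)"
  have f: "f \<in> X \<rightarrow>\<^sub>E X"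
    using ab sub by (auto simp: f_def)
  have "{x \<in> X. f x = a} = A" "{x \<in> X. f x = b} = B"
    using ab sub disj by (auto simp: f_def)
  then have "star f \<xi> = a" "star f \<xi> = b"
    using assms preimage_in_points_iff[OF f _ \<xi>] ab sub by blast+
  then show False
    using ab disj by blast
qed

lemma ultrafilter_on_points:
  assumes \<xi>: "\<xi> \<in> SX"
  shows "ultrafilter_on X (points \<xi>)"
proof (rule ultrafilter_onI_not_disjoint)
  show "points \<xi> \<subseteq> Pow X"
    by (auto simp: point_ultrafilter_def)
qed (use \<xi> in \<open>simp_all add: iff_in_points_iff points_not_disjoint\<close>)

lemma product_ultrafilter_eq_sum:
  "product_ultrafilter X zero one SX star V = sum_ultrafilter SX (\<lambda>_. X) V points"
  by (simp add: product_ultrafilter_def sum_ultrafilter_def)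

lemma ultrafilter_on_product_ultrafilter:
  "ultrafilter_on SX V \<Longrightarrow> ultrafilter_on (SX \<times> X) (product_ultrafilter X zero one SX star V)"
  by (simp add: product_ultrafilter_eq_sum ultrafilter_on_sum_ultrafilter ultrafilter_on_points)

definition section_value :: "('a \<times> 'a \<Rightarrow> 'a) \<Rightarrow> 'a \<Rightarrow> 'a" where
  "section_value f \<xi> = star (\<lambda>x\<in>X. f (\<xi>, x)) \<xi>"

lemma section_in_PiE: "f \<in> SX \<times> X \<rightarrow>\<^sub>E X \<Longrightarrow> \<xi> \<in> SX \<Longrightarrow> (\<lambda>x\<in>X. f (\<xi>, x)) \<in> X \<rightarrow>\<^sub>E X"
  by (auto intro: PiE_mem)

lemma equalizer_in_product_ultrafilter_iff:
  assumes f: "f \<in> SX \<times> X \<rightarrow>\<^sub>E X" and g: "g \<in> SX \<times> X \<rightarrow>\<^sub>E X"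
  shows "{i \<in> SX \<times> X. f i = g i} \<in> product_ultrafilter X zero one SX star V \<longleftrightarrow>
    {\<xi> \<in> SX. section_value f \<xi> = section_value g \<xi>} \<in> V"
proof -
  have "{x \<in> X. f (\<xi>, x) = g (\<xi>, x)} \<in> points \<xi> \<longleftrightarrow> section_value f \<xi> = section_value g \<xi>"
    if \<xi>: "\<xi> \<in> SX" for \<xi>
  proof -
    have "{x \<in> X. f (\<xi>, x) = g (\<xi>, x)} = {x \<in> X. (\<lambda>x\<in>X. f (\<xi>, x)) x = (\<lambda>x\<in>X. g (\<xi>, x)) x}"
      by auto
    then show ?thesis
      using equalizer_in_points_iff[OF section_in_PiE[OF f \<xi>] section_in_PiE[OF g \<xi>] \<xi>]
      by (simp add: section_value_def)
  qed
  then show ?thesis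
    by (simp add: product_ultrafilter_eq_sum Collect_in_sum_ultrafilter_iff cong: conj_cong)
qed

lemma section_value_compose:
  assumes "f \<in> SX \<times> X \<rightarrow>\<^sub>E X" and "g \<in> X \<rightarrow>\<^sub>E X" and "\<xi> \<in> SX"
  shows "section_value (compose (SX \<times> X) g f) \<xi> = star g (section_value f \<xi>)"
proof -
  have "(\<lambda>x\<in>X. compose (SX \<times> X) g f (\<xi>, x)) = compose X g (\<lambda>x\<in>X. f (\<xi>, x))"
    using assms(3) by (auto simp: compose_def)
  then show ?thesis
    using comp[OF section_in_PiE[OF assms(1,3)] assms(2,3)] by (simp add: section_value_def)
qed

end

locale limit_ultrapower_construction = functional_extension +
  fixes F :: "'a \<Rightarrow> 'a \<Rightarrow> 'a \<Rightarrow> 'a" and V :: "'a set set"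
  assumes choice: "admissible_choice X SX star F"
    and ultrafilter_V: "ultrafilter_on SX V"
    and check_in: "\<alpha> \<in> SX \<Longrightarrow> check_set X SX star \<alpha> \<in> V"
begin

abbreviation "hat \<equiv> hat_fun X SX star F"

abbreviation "\<D> \<equiv> product_ultrafilter X zero one SX star V"

abbreviation "\<E> \<equiv> generated_equivs (SX \<times> X) {eq_kernel (SX \<times> X) (hat \<alpha>) | \<alpha>. \<alpha> \<in> SX}"

abbreviation "class_of \<equiv> ultrapower_class X (SX \<times> X) \<D>"

lemma choice_in_PiE:
  "\<alpha> \<in> SX \<Longrightarrow> \<xi> \<in> check_set X SX star \<alpha> \<Longrightarrow> F \<xi> \<alpha> \<in> X \<rightarrow>\<^sub>E X"
  using choice by (simp add: admissible_choice_def)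

lemma hat_in_PiE:
  assumes "\<alpha> \<in> SX"
  shows "hat \<alpha> \<in> SX \<times> X \<rightarrow>\<^sub>E X"
proof (rule PiE_I)
  fix i assume "i \<in> SX \<times> X"
  then show "hat \<alpha> i \<in> X"
    using PiE_mem[OF choice_in_PiE[OF assms]] by (auto simp: hat_fun_def)
qed (simp add: hat_fun_def)

lemma section_value_hat:
  assumes \<alpha>: "\<alpha> \<in> SX" and \<xi>: "\<xi> \<in> check_set X SX star \<alpha>"
  shows "section_value (hat \<alpha>) \<xi> = \<alpha>"
proof -
  have "\<xi> \<in> SX"
    using \<xi> by (simp add: check_set_def)
  then have "(\<lambda>x\<in>X. hat \<alpha> (\<xi>, x)) = restrict (F \<xi> \<alpha>) X"
    using \<xi> by (intro restrict_ext) (simp add: hat_fun_def)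
  also have "\<dots> = F \<xi> \<alpha>"
    using choice_in_PiE[OF assms] by (simp add: PiE_restrict)
  finally show ?thesis
    using choice assms by (simp add: section_value_def admissible_choice_def)
qed

lemma class_of_eq_iff:
  assumes "f \<in> SX \<times> X \<rightarrow>\<^sub>E X" and "g \<in> SX \<times> X \<rightarrow>\<^sub>E X"
  shows "class_of f = class_of g \<longleftrightarrow> {\<xi> \<in> SX. section_value f \<xi> = section_value g \<xi>} \<in> V"
  using ultrapower_class_eq_iff[OF ultrafilter_on_product_ultrafilter[OF ultrafilter_V] assms]
    equalizer_in_product_ultrafilter_iff[OF assms] by simp

lemma check_Int_in:
  assumes "\<alpha> \<in> SX" and "\<beta> \<in> SX"
  shows "check_set X SX star \<alpha> \<inter> check_set X SX star \<beta> \<in> V"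
  using ultrafilter_V check_in[OF assms(1)] check_in[OF assms(2)] by (simp add: ultrafilter_on_def)

lemma class_of_hat_eq_iff:
  assumes "\<alpha> \<in> SX" and "\<beta> \<in> SX"
  shows "class_of (hat \<alpha>) = class_of (hat \<beta>) \<longleftrightarrow> \<alpha> = \<beta>"
proof -
  have "{\<xi> \<in> SX. section_value (hat \<alpha>) \<xi> = section_value (hat \<beta>) \<xi>} \<in> V \<longleftrightarrow> \<alpha> = \<beta>"
    using assms
    by (intro ultrafilter_on_Collect_const_iff[OF ultrafilter_V check_Int_in[OF assms]])
      (simp add: section_value_hat)
  then show ?thesis
    using assms by (simp add: class_of_eq_iff hat_in_PiE)
qed

lemma class_of_hat_star:
  assumes g: "g \<in> X \<rightarrow>\<^sub>E X" and \<alpha>: "\<alpha> \<in> SX"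
  shows "class_of (hat (star g \<alpha>)) = class_of (compose (SX \<times> X) g (hat \<alpha>))"
proof -
  have star: "star g \<alpha> \<in> SX"
    using star_fun[OF g] \<alpha> by blast
  have "section_value (hat (star g \<alpha>)) \<xi> = section_value (compose (SX \<times> X) g (hat \<alpha>)) \<xi>"
    if \<xi>: "\<xi> \<in> check_set X SX star (star g \<alpha>) \<inter> check_set X SX star \<alpha>" for \<xi>
  proof -
    have "\<xi> \<in> SX"
      using \<xi> by (simp add: check_set_def)
    then show ?thesis
      using \<xi> section_value_compose[OF hat_in_PiE[OF \<alpha>] g] by (simp add: section_value_hat star \<alpha>)
  qed
  then have "{\<xi> \<in> SX. section_value (hat (star g \<alpha>)) \<xi> =
      section_value (compose (SX \<times> X) g (hat \<alpha>)) \<xi>} \<in> V"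
    using ultrafilter_on_Collect_const_iff[OF ultrafilter_V check_Int_in[OF star \<alpha>], where Q = True]
    by simp
  then show ?thesis
    by (simp add: class_of_eq_iff hat_in_PiE PiE_compose[OF _ g] star \<alpha>)
qed

lemma class_of_hat_image: "(\<lambda>\<alpha>. class_of (hat \<alpha>)) ` SX = limit_ultrapower X (SX \<times> X) \<D> \<E>"
proof
  let ?id = "\<lambda>x\<in>X. x"
  have limit: "limit_ultrapower X (SX \<times> X) \<D> \<E> =
      {class_of (compose (SX \<times> X) g (hat \<alpha>)) | g \<alpha>. g \<in> X \<rightarrow>\<^sub>E X \<and> \<alpha> \<in> SX}"
    by (rule limit_ultrapower_generated_equivs[OF hat_in_PiE]) (use zero_in in auto)
  show "(\<lambda>\<alpha>. class_of (hat \<alpha>)) ` SX \<subseteq> limit_ultrapower X (SX \<times> X) \<D> \<E>"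
  proof (rule image_subsetI)
    fix \<alpha> assume \<alpha>: "\<alpha> \<in> SX"
    have "compose (SX \<times> X) ?id (hat \<alpha>) = hat \<alpha>"
      using hat_in_PiE[OF \<alpha>] by (simp add: PiE_def Id_compose)
    moreover have "?id \<in> X \<rightarrow>\<^sub>E X"
      by simp
    ultimately show "class_of (hat \<alpha>) \<in> limit_ultrapower X (SX \<times> X) \<D> \<E>"
      unfolding limit using \<alpha> by (metis (mono_tags, lifting) mem_Collect_eq)
  qed
  show "limit_ultrapower X (SX \<times> X) \<D> \<E> \<subseteq> (\<lambda>\<alpha>. class_of (hat \<alpha>)) ` SX"
    unfolding limit using class_of_hat_star star_fun by blast
qed

end

theorem theorem2p1:
  fixes X SX :: "'a set" and zero one :: 'a
    and star :: "('a \<Rightarrow> 'a) \<Rightarrow> 'a \<Rightarrow> 'a"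
    and F :: "'a \<Rightarrow> 'a \<Rightarrow> 'a \<Rightarrow> 'a"
    and V :: "'a set set"
    and I :: "('a \<times> 'a) set"
    and hat :: "'a \<Rightarrow> 'a \<times> 'a \<Rightarrow> 'a"
    and \<D> :: "('a \<times> 'a) set set"
    and \<E> :: "(('a \<times> 'a) \<times> ('a \<times> 'a)) set set"
  assumes "directed_functional_extension X zero one SX star"
    and "admissible_choice X SX star F"
    and "ultrafilter_on SX V"
    and "\<forall>\<alpha>\<in>SX. check_set X SX star \<alpha> \<in> V"
    and "I = SX \<times> X"
    and "hat = hat_fun X SX star F"
    and "\<D> = product_ultrafilter X zero one SX star V"
    and "\<E> = generated_equivs I {eq_kernel I (hat \<alpha>) | \<alpha>. \<alpha> \<in> SX}"
  shows "fun_language_iso X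
           SX star
           (limit_ultrapower X I \<D> \<E>) (ultrapower_fun X I \<D>)
           (\<lambda>\<alpha>. ultrapower_class X I \<D> (hat \<alpha>))
       \<and> (\<forall>g \<in> X \<rightarrow>\<^sub>E X. \<forall>\<alpha>\<in>SX.
           ultrapower_class X I \<D> (hat (star g \<alpha>)) =
           ultrapower_class X I \<D> (compose I g (hat \<alpha>)))"
proof -
  interpret ext: limit_ultrapower_construction X zero one SX star F V
    using assms(1-4)
    by (simp add: limit_ultrapower_construction_def limit_ultrapower_construction_axioms_def
        directed_functional_extension_def)
  have "bij_betw (\<lambda>\<alpha>. ext.class_of (ext.hat \<alpha>)) SX (limit_ultrapower X (SX \<times> X) ext.\<D> ext.\<E>)"
    using ext.class_of_hat_eq_iff ext.class_of_hat_image by (simp add: bij_betw_def inj_on_def)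
  moreover have "ultrapower_fun X (SX \<times> X) ext.\<D> g (ext.class_of (ext.hat \<alpha>)) =
      ext.class_of (compose (SX \<times> X) g (ext.hat \<alpha>))" if "g \<in> X \<rightarrow>\<^sub>E X" "\<alpha> \<in> SX" for g \<alpha>
    using ultrapower_fun_class ext.ultrafilter_on_product_ultrafilter[OF ext.ultrafilter_V] that(1)
      ext.hat_in_PiE[OF that(2)] .
  ultimately show ?thesis
    unfolding assms(5-8) fun_language_iso_def using ext.class_of_hat_star by simp
qed

end
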